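(* For $\omega\in(0,2)$ and for any initial input $\vec{x}^{(0)}\in\mathcal{R}(\mathcal{S}^* )$, the sequence given by $$\vec{x}^{(n+1)}=\widehat{\mathcal{B}}^{\omega}\vec{x}^{(n)}+\vec{\mathbf{b}}^{\omega}$$ converges to a unique point in $\mathcal{R}(\mathcal{S}^* )$, independent of $\vec{x}^{(0)}$, and the convergence rate is linear (i.e. the error is bounded by $Cq^n$ for some constants $C\geq 0$ and $q\in(0,1)$).
   Context: A finite tree with root $r$ and leaves $\ell_1,\dots,\ell_t$ (set of leaves $\mathcal{L}$) is given. Each node $v$ carries a nonzero vector $\vec{a}_v\in\mathbb{C}^d$ and a scalar $b_v\in\mathbb{C}$; no consistency of the system of equations $\vec{a}_v\cdot\vec{x}=b_v$ is assumed. $S_v:\mathbb{C}^d\to\mathbb{C}$ is $S_v\vec{z}=\vec{a}_v\cdot\vec{z}=\sum_k a_{v,k}z_k$. $\mathcal{R}(\cdot)$ denotes range. Each edge between a node $v$ and a child $u$ of $v$ carries a weight $w(u,v)>0$, and for each non-leaf $v$ the weights over its children sum to $1$. For a leaf $\ell$, $w(\ell,r)$ is the product of the edge weights along the path from $r$ to $\ell$. The nodes on this path are $r=(\ell,1),\dots,(\ell,p_\ell)=\ell$, with $S_{\ell,j}$, $b_{\ell,j}$ the corresponding $S_v$, $b_v$. For each leaf $\ell$: $\mathcal{S}_\ell:\mathbb{C}^d\to\mathbb{C}^{p_\ell}$ is the column of $S_{\ell,1},\dots,S_{\ell,p_\ell}$; $\vec{b}_\ell=(b_{\ell,1},\dots,b_{\ell,p_\ell})^T$;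 $\mathcal{D}_\ell$ is the diagonal matrix with entries $S_{\ell,j}S_{\ell,j}^*$; $\mathcal{L}_\ell$ is the strictly lower triangular matrix with $(i,j)$ entry $S_{\ell,i}S_{\ell,j}^*$ for $i>j$. Let $\mathcal{S}$ be the column of $\mathcal{S}_{\ell_1},\dots,\mathcal{S}_{\ell_t}$, $\vec{\mathbf{b}}$ the column of $\vec{b}_{\ell_1},\dots,\vec{b}_{\ell_t}$, and let $\mathcal{D}$, $\widetilde{\mathcal{L}}$, $\mathcal{W}$ be the block diagonal matrices with blocks $\mathcal{D}_{\ell_i}$, $\mathcal{L}_{\ell_i}$, $w(\ell_i,r)I_{p_{\ell_i}}$ respectively. Set $$\mathcal{B}^\omega=I-\omega\mathcal{S}^*(\mathcal{D}+\omega\widetilde{\mathcal{L}})^{-1}\mathcal{W}\mathcal{S},\qquad \vec{\mathbf{b}}^\omega=\omega\mathcal{S}^*(\mathcal{D}+\omega\widetilde{\mathcal{L}})^{-1}\mathcal{W}\vec{\mathbf{b}}.$$ $\mathcal{R}(\mathcal{S}^* )$ is invariant under $\mathcal{B}^\omega$ and contains $\vec{\mathbf{b}}^\omega$, and $\widehat{\mathcal{B}}^\omega$ is the restriction of $\mathcal{B}^\omega$ to $\mathcal{R}(\mathcal{S}^* )$. *)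

theory Defs
  imports
    "Jordan_Normal_Form.Schur_Decomposition"
    "Jordan_Normal_Form.Gauss_Jordan_Elimination"
    "HOL-Analysis.L2_Norm"
    "HOL-Library.FuncSet"
begin

text \<open>A rooted tree is given by its node set, its root and a parent function, whose value at
  the root is irrelevant.  The weight of the edge between a node \<open>v\<close> and its child \<open>u\<close> is
  \<open>weight T u v\<close>; the equation attached to \<open>v\<close> is \<open>coef T v \<bullet> x = rhs T v\<close> (bilinear
  product, no conjugation).  The list \<open>leaf_list T\<close> is the enumeration of the leaves that fixes
  the block order of the stacked matrices.\<close>

record 'v tree_system =
  nodes :: "'v set"
  tree_root :: 'v
  parent :: "'v \<Rightarrow> 'v"
  weight :: "'v \<Rightarrow> 'v \<Rightarrow> real"
  space_dim :: nat
  coef :: "'v \<Rightarrow> complex vec"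
  rhs :: "'v \<Rightarrow> complex"
  leaf_list :: "'v list"

definition children :: "'v tree_system \<Rightarrow> 'v \<Rightarrow> 'v set" where
  "children T v = {u \<in> nodes T. u \<noteq> tree_root T \<and> parent T u = v}"

definition leaves :: "'v tree_system \<Rightarrow> 'v set" where
  "leaves T = {v \<in> nodes T. children T v = {}}"

locale kaczmarz_tree =
  fixes T :: "'v tree_system"
  assumes finite_nodes: "finite (nodes T)"
    and root_in_nodes: "tree_root T \<in> nodes T"
    and parent_in_nodes:
      "\<And>v. v \<in> nodes T \<Longrightarrow> v \<noteq> tree_root T \<Longrightarrow> parent T v \<in> nodes T"
    and reaches_root: "\<And>v. v \<in> nodes T \<Longrightarrow> \<exists>k. (parent T ^^ k) v = tree_root T"
    and coef_carrier: "\<And>v. v \<in> nodes T \<Longrightarrow> coef T v \<in> carrier_vec (space_dim T)"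
    and coef_nonzero: "\<And>v. v \<in> nodes T \<Longrightarrow> coef T v \<noteq> 0\<^sub>v (space_dim T)"
    and weight_pos: "\<And>u v. v \<in> nodes T \<Longrightarrow> u \<in> children T v \<Longrightarrow> weight T u v > 0"
    and weight_sum:
      "\<And>v. v \<in> nodes T \<Longrightarrow> v \<notin> leaves T \<Longrightarrow> (\<Sum>u\<in>children T v. weight T u v) = 1"
    and leaf_list_distinct: "distinct (leaf_list T)"
    and leaf_list_set: "set (leaf_list T) = leaves T"

definition depth :: "'v tree_system \<Rightarrow> 'v \<Rightarrow> nat" where
  "depth T v = (LEAST k. (parent T ^^ k) v = tree_root T)"

text \<open>The nodes from the root down to \<open>v\<close>, both included; list positions are counted from 0.\<close>

definition root_path :: "'v tree_system \<Rightarrow> 'v \<Rightarrow> 'v list" where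
  "root_path T v = map (\<lambda>k. (parent T ^^ k) v) (rev [0..<Suc (depth T v)])"

definition path_weight :: "'v tree_system \<Rightarrow> 'v \<Rightarrow> real" where
  "path_weight T v = (\<Prod>k<depth T v. weight T ((parent T ^^ k) v) ((parent T ^^ Suc k) v))"

definition S_leaf :: "'v tree_system \<Rightarrow> 'v \<Rightarrow> complex mat" where
  "S_leaf T l = mat_of_rows (space_dim T) (map (coef T) (root_path T l))"

definition b_leaf :: "'v tree_system \<Rightarrow> 'v \<Rightarrow> complex vec" where
  "b_leaf T l = vec_of_list (map (rhs T) (root_path T l))"

text \<open>The functional \<open>S\<^sub>v\<close> is the row \<open>coef T v\<close> and its adjoint is the conjugate column, so the
  scalar \<open>S\<^sub>u S\<^sub>v\<^sup>*\<close> is \<open>coef T u \<bullet>c coef T v\<close>.\<close>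

definition D_leaf :: "'v tree_system \<Rightarrow> 'v \<Rightarrow> complex mat" where
  "D_leaf T l = (let p = root_path T l in
     mat (length p) (length p)
       (\<lambda>(i, j). if i = j then coef T (p ! i) \<bullet>c coef T (p ! j) else 0))"

definition L_leaf :: "'v tree_system \<Rightarrow> 'v \<Rightarrow> complex mat" where
  "L_leaf T l = (let p = root_path T l in
     mat (length p) (length p)
       (\<lambda>(i, j). if i > j then coef T (p ! i) \<bullet>c coef T (p ! j) else 0))"

definition W_leaf :: "'v tree_system \<Rightarrow> 'v \<Rightarrow> complex mat" where
  "W_leaf T l = complex_of_real (path_weight T l) \<cdot>\<^sub>m 1\<^sub>m (length (root_path T l))"

definition S_mat :: "'v tree_system \<Rightarrow> complex mat" where
  "S_mat T = mat_of_rows (space_dim T) (concat (map (\<lambda>l. rows (S_leaf T l)) (leaf_list T)))"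

definition b_stack :: "'v tree_system \<Rightarrow> complex vec" where
  "b_stack T = vec_of_list (concat (map (\<lambda>l. list_of_vec (b_leaf T l)) (leaf_list T)))"

definition D_mat :: "'v tree_system \<Rightarrow> complex mat" where
  "D_mat T = diag_block_mat (map (D_leaf T) (leaf_list T))"

definition L_mat :: "'v tree_system \<Rightarrow> complex mat" where
  "L_mat T = diag_block_mat (map (L_leaf T) (leaf_list T))"

definition W_mat :: "'v tree_system \<Rightarrow> complex mat" where
  "W_mat T = diag_block_mat (map (W_leaf T) (leaf_list T))"

text \<open>The matrix \<open>D + \<omega>L\<close> is lower triangular with the nonzero numbers \<open>S\<^sub>v S\<^sub>v\<^sup>*\<close> on its diagonal,
  so \<open>mat_inverse\<close> does not return \<open>None\<close> here.\<close>

definition DL_inv :: "'v tree_system \<Rightarrow> real \<Rightarrow> complex mat" where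
  "DL_inv T \<omega> = the (mat_inverse (D_mat T + complex_of_real \<omega> \<cdot>\<^sub>m L_mat T))"

definition B_mat :: "'v tree_system \<Rightarrow> real \<Rightarrow> complex mat" where
  "B_mat T \<omega> = 1\<^sub>m (space_dim T) -
     complex_of_real \<omega> \<cdot>\<^sub>m (mat_adjoint (S_mat T) * DL_inv T \<omega> * W_mat T * S_mat T)"

definition b_vec :: "'v tree_system \<Rightarrow> real \<Rightarrow> complex vec" where
  "b_vec T \<omega> =
     complex_of_real \<omega> \<cdot>\<^sub>v ((mat_adjoint (S_mat T) * DL_inv T \<omega> * W_mat T) *\<^sub>v b_stack T)"

definition mat_range :: "complex mat \<Rightarrow> complex vec set" where
  "mat_range A = (\<lambda>y. A *\<^sub>v y) ` carrier_vec (dim_col A)"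

definition range_S_adj :: "'v tree_system \<Rightarrow> complex vec set" where
  "range_S_adj T = mat_range (mat_adjoint (S_mat T))"

definition B_hat :: "'v tree_system \<Rightarrow> real \<Rightarrow> complex vec \<Rightarrow> complex vec" where
  "B_hat T \<omega> = restrict (\<lambda>z. B_mat T \<omega> *\<^sub>v z) (range_S_adj T)"

definition kaczmarz_seq :: "'v tree_system \<Rightarrow> real \<Rightarrow> (nat \<Rightarrow> complex vec) \<Rightarrow> bool" where
  "kaczmarz_seq T \<omega> x \<longleftrightarrow>
     x 0 \<in> range_S_adj T \<and> (\<forall>n. x (Suc n) = B_hat T \<omega> (x n) + b_vec T \<omega>)"

definition cvec_norm :: "complex vec \<Rightarrow> real" where
  "cvec_norm v = L2_set (\<lambda>i. cmod (v $ i)) {..<dim_vec v}"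

definition cvec_tendsto :: "(nat \<Rightarrow> complex vec) \<Rightarrow> complex vec \<Rightarrow> bool" where
  "cvec_tendsto x y \<longleftrightarrow> (\<lambda>n. cvec_norm (x n - y)) \<longlonglongrightarrow> 0"

end

theory Submission
  imports Defs "Jordan_Normal_Form.Spectral_Radius"
begin

text \<open>For a leaf \<open>l\<close> of weight \<open>w\<^sub>l\<close>, forward substitution in the triangular block
  \<open>D\<^sub>l + \<omega>L\<^sub>l\<close> shows that \<open>P\<^sub>l = I - \<omega>S\<^sub>l\<^sup>*(D\<^sub>l + \<omega>L\<^sub>l)\<inverse>S\<^sub>l\<close> is one sweep of relaxed
  Kaczmarz steps along the path to \<open>l\<close>.  For \<open>0 < \<omega> < 2\<close> each step decreases the norm, unless
  it does not move the point at all.  The leaf weights sum to 1, so \<open>B = \<Sum> w\<^sub>l P\<^sub>l\<close> is an average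
  of these sweeps: by convexity \<open>\<parallel>Bx\<parallel> \<le> \<parallel>x\<parallel>\<close>, with equality only if \<open>Sx = 0\<close>.  The range of
  \<open>S\<^sup>*\<close> meets the kernel of \<open>S\<close> only in 0, so \<open>B\<close> has spectral radius less than 1 on this
  range, which gives a unique fixed point of the affine iteration and geometric convergence.\<close>

section \<open>Generalized inverses and powers of matrices with small spectral radius\<close>

lemma smult_mat_mult_vec:
  assumes "dim_vec v = dim_col A"
  shows "(c \<cdot>\<^sub>m A) *\<^sub>v v = c \<cdot>\<^sub>v (A *\<^sub>v (v :: 'a :: comm_semiring_0 vec))"
  using assms by (intro eq_vecI) (auto simp: scalar_prod_def sum_distrib_left ac_simps)

text \<open>Row reduction reduces the claim to a reduced row echelon form \<open>R\<close>, whose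
  pivot columns are unit vectors, so that selecting these columns inverts \<open>R\<close> on its
  nonzero rows. The purpose is that \<open>A * G\<close> is a projection onto the range of
  \<open>A\<close>.\<close>

lemma ex_generalized_inverse:
  fixes A :: "'a :: field mat"
  assumes A: "A \<in> carrier_mat nr nc"
  shows "\<exists>G \<in> carrier_mat nc nr. A * G * A = A"
proof -
  obtain R P Q where R: "R = P * A" and rf: "row_echelon_form R" and Rc: "R \<in> carrier_mat nr nc"
    and P: "P \<in> carrier_mat nr nr" and Q: "Q \<in> carrier_mat nr nr" and QP: "Q * P = 1\<^sub>m nr"
    using gauss_jordan_single(2-4)[OF A refl] by blast
  from rf Rc obtain f where "pivot_fun R f nc"
    unfolding row_echelon_form_def by auto
  note f = pivot_funD[OF _ this, of nr]
  \<comment> \<open>Column \<open>i\<close> of \<open>H\<close> picks the pivot column of row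
    \<open>i\<close>. A zero row has \<open>f i = nc\<close> and gets a zero column, so
    \<open>R * H\<close> is diagonal with entry 1 exactly at the nonzero rows of
    \<open>R\<close>.\<close>
  define H :: "'a mat" where "H = mat nc nr (\<lambda>(j, i). if j = f i then 1 else 0)"
  have H: "H \<in> carrier_mat nc nr" by (simp add: H_def)
  have RH: "(R * H) $$ (k, i) = (if f i < nc then if k = i then 1 else 0 else 0)"
    if "k < nr" "i < nr" for k i
  proof -
    have "(R * H) $$ (k, i) = (\<Sum>j<nc. R $$ (k, j) * (if j = f i then 1 else 0))"
      using that Rc by (simp add: H_def scalar_prod_def lessThan_atLeast0)
    also have "\<dots> = (\<Sum>j<nc. if j = f i then R $$ (k, j) else 0)"
      by (rule sum.cong) auto
    also have "\<dots> = (if f i < nc then R $$ (k, f i) else 0)"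
      by simp
    finally show ?thesis using that f(4)[of i] f(5)[of i k] Rc by auto
  qed
  have RHR: "R * H * R = R"
  proof (rule eq_matI)
    fix k j assume "k < dim_row R" "j < dim_col R"
    hence k: "k < nr" and j: "j < nc" using Rc by auto
    have "(X * R) $$ (k, j) = (\<Sum>i<nr. X $$ (k, i) * R $$ (i, j))"
      if "X \<in> carrier_mat nr nr" for X
      using k j Rc that by (simp add: scalar_prod_def lessThan_atLeast0)
    hence "(R * H * R) $$ (k, j) = (\<Sum>i<nr. (R * H) $$ (k, i) * R $$ (i, j))"
      using mult_carrier_mat[OF Rc H] by blast
    also have "\<dots> = (\<Sum>i<nr. if k = i then R $$ (i, j) else 0)"
    proof (rule sum.cong)
      fix i assume "i \<in> {..<nr}"
      hence i: "i < nr" by simp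
      have "R $$ (i, j) = 0" if "\<not> f i < nc"
        using f(2)[of i j] i j that Rc by auto
      thus "(R * H) $$ (k, i) * R $$ (i, j) = (if k = i then R $$ (i, j) else 0)"
        using RH[OF k i] by auto
    qed simp
    also have "\<dots> = R $$ (k, j)" using k by simp
    finally show "(R * H * R) $$ (k, j) = R $$ (k, j)" .
  qed (use Rc H in auto)
  have QR: "Q * R = A"
    using assoc_mult_mat[OF Q P A] QP A R by simp
  have "A * (H * P) * A = A"
  proof -
    have "A * (H * P) * A = A * (H * (P * A))"
      using A H P by (simp add: assoc_mult_mat[of _ nr nc _ nr _ nc] assoc_mult_mat[of _ nc nr _ nr _ nc])
    also have "\<dots> = Q * R * (H * R)" using R QR by simp
    also have "\<dots> = Q * (R * H * R)"
      using Q Rc H by (simp add: assoc_mult_mat[of _ nr nr _ nc _ nc] assoc_mult_mat[of _ nr nc _ nr _ nc])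
    finally show ?thesis using RHR QR by simp
  qed
  thus ?thesis using H P by (intro bexI[of _ "H * P"]) auto
qed

text \<open>For \<open>q\<close> strictly between the spectral radius and 1, the matrix
  \<open>A\<close> divided by \<open>q\<close> still has spectral radius below 1, so its powers are
  bounded. Scaling back produces the factor \<open>q ^ k\<close>.\<close>

lemma spectral_radius_less_1_geometric_bound:
  fixes A :: "complex mat"
  assumes A: "A \<in> carrier_mat n n" and n: "n > 0" and sr: "spectral_radius A < 1"
  shows "\<exists>q \<in> {0<..<1}. \<exists>c \<ge> 0. \<forall>k. norm_bound (A ^\<^sub>m k) (c * q ^ k)"
proof -
  have sr0: "spectral_radius A \<ge> 0"
    using spectral_radius_mem_max(1)[OF A n] by auto
  \<comment> \<open>The midpoint is positive even when the spectral radius is 0, so dividing by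
    \<open>q\<close> is safe.\<close>
  define q where "q = (spectral_radius A + 1) / 2"
  have q: "0 < q" "q < 1" "spectral_radius A < q"
    using sr sr0 by (auto simp: q_def)
  define A' where "A' = complex_of_real (1 / q) \<cdot>\<^sub>m A"
  have A': "A' \<in> carrier_mat n n" using A by (simp add: A'_def)
  have AA': "A = complex_of_real q \<cdot>\<^sub>m A'"
    using q A by (intro eq_matI) (auto simp: A'_def)
  have "spectral_radius A' < 1"
  proof -
    obtain ev where ev: "eigenvalue A' ev" and sr': "spectral_radius A' = norm ev"
      using spectral_radius_mem_max(1)[OF A' n] by (auto simp: spectrum_def)
    from ev obtain v where v: "v \<in> carrier_vec n" "v \<noteq> 0\<^sub>v n" "A' *\<^sub>v v = ev \<cdot>\<^sub>v v"
      using A' by (auto simp: eigenvalue_def eigenvector_def)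
    have "A *\<^sub>v v = (complex_of_real q * ev) \<cdot>\<^sub>v v"
      unfolding AA' using v A' by (simp add: smult_mat_mult_vec smult_smult_assoc)
    hence "eigenvalue A (complex_of_real q * ev)"
      using v A by (auto simp: eigenvalue_def eigenvector_def)
    hence "norm (complex_of_real q * ev) \<le> spectral_radius A"
      by (intro spectral_radius_mem_max(2)[OF A n]) (auto simp: spectrum_def)
    hence "q * norm ev \<le> spectral_radius A" using q by (simp add: norm_mult)
    hence "q * norm ev < q * 1" using q by linarith
    thus ?thesis using q sr' by (simp only: mult_less_cancel_left_pos)
  qed
  from spectral_radius_jnf_norm_bound_less_1_upper_triangular[OF A' this]
  obtain c where c: "\<And>k. norm_bound (A' ^\<^sub>m k) c" by auto
  have pow: "A ^\<^sub>m k = complex_of_real (q ^ k) \<cdot>\<^sub>m (A' ^\<^sub>m k)" for k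
  proof (induction k)
    case 0
    then show ?case using A A' by (intro eq_matI) auto
  next
    case (Suc k)
    have "A ^\<^sub>m Suc k = (complex_of_real (q ^ k) \<cdot>\<^sub>m (A' ^\<^sub>m k)) * (complex_of_real q \<cdot>\<^sub>m A')"
      using Suc AA' by simp
    also have "\<dots> = complex_of_real (q ^ Suc k) \<cdot>\<^sub>m (A' ^\<^sub>m Suc k)"
      using A' pow_carrier_mat[OF A', of k]
      by (intro eq_matI) (auto simp: scalar_prod_def sum_distrib_left ac_simps intro!: sum.cong)
    finally show ?case .
  qed
  have "norm_bound (A ^\<^sub>m k) (max c 0 * q ^ k)" for k
  proof
    fix i j assume "i < dim_row (A ^\<^sub>m k)" "j < dim_col (A ^\<^sub>m k)"
    hence ij: "i < dim_row (A' ^\<^sub>m k)" "j < dim_col (A' ^\<^sub>m k)" by (auto simp: pow)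
    have "norm ((A ^\<^sub>m k) $$ (i, j)) = norm ((A' ^\<^sub>m k) $$ (i, j)) * q ^ k"
      using ij q by (simp add: pow norm_mult norm_power)
    also have "\<dots> \<le> max c 0 * q ^ k"
      using c[of k] ij q by (intro mult_right_mono) (force simp: norm_bound_def)+
    finally show "norm ((A ^\<^sub>m k) $$ (i, j)) \<le> max c 0 * q ^ k" .
  qed
  thus ?thesis using q by (intro bexI[of _ q] exI[of _ "max c 0"]) auto
qed

section \<open>Energy loss along one sweep, and convexity of the squared modulus\<close>

text \<open>The hypothesis on \<open>z\<close> is the triangular system of one path. Its row
  \<open>i\<close> says that \<open>s i * z i\<close> is the product of \<open>a i\<close> with the
  point reached after the first \<open>i\<close> steps. Step \<open>i\<close> therefore subtracts
  \<open>\<omega> * z i\<close> times the conjugate of \<open>a i\<close>, a relaxed projection for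
  the equation with right-hand side 0, and expanding the square shows that it lowers the squared
  norm by \<open>\<omega> * (2 - \<omega>) * s i * (cmod (z i))\<^sup>2\<close>.\<close>

lemma kaczmarz_sweep_energy:
  fixes d :: nat and a :: "nat \<Rightarrow> nat \<Rightarrow> complex" and x z :: "nat \<Rightarrow> complex" and \<omega> :: real
  defines "s \<equiv> \<lambda>i. \<Sum>k<d. (cmod (a i k))\<^sup>2"
  assumes z: "\<And>i. i < p \<Longrightarrow>
    (\<Sum>k<d. a i k * x k) = s i * z i + \<omega> * (\<Sum>j<i. (\<Sum>k<d. a i k * cnj (a j k)) * z j)"
  shows "(\<Sum>k<d. (cmod (x k - \<omega> * (\<Sum>j<p. cnj (a j k) * z j)))\<^sup>2) =
    (\<Sum>k<d. (cmod (x k))\<^sup>2) - \<omega> * (2 - \<omega>) * (\<Sum>i<p. s i * (cmod (z i))\<^sup>2)"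
  using z
proof (induction p)
  case 0
  then show ?case by simp
next
  case (Suc p)
  define y where "y = (\<lambda>k. x k - \<omega> * (\<Sum>j<p. cnj (a j k) * z j))"
  have "(\<Sum>k<d. a p k * y k) =
    (\<Sum>k<d. a p k * x k) - \<omega> * (\<Sum>k<d. \<Sum>j<p. a p k * cnj (a j k) * z j)"
    by (simp add: y_def algebra_simps sum_subtractf sum_distrib_left)
  also have "(\<Sum>k<d. \<Sum>j<p. a p k * cnj (a j k) * z j) = (\<Sum>j<p. (\<Sum>k<d. a p k * cnj (a j k)) * z j)"
    by (subst sum.swap) (simp add: sum_distrib_right)
  finally have ay: "(\<Sum>k<d. a p k * y k) = s p * z p"
    using Suc.prems[of p] by simp
  \<comment> \<open>After summation over \<open>k\<close>, \<open>ay\<close> turns the mixed term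
    into \<open>- 2 * \<omega>\<close> times \<open>s p * (cmod (z p))\<^sup>2\<close>, while the
    last term gives \<open>\<omega>\<^sup>2\<close> times the same quantity.\<close>
  have sq: "(cmod (y k - \<omega> * (cnj (a p k) * z p)))\<^sup>2 =
     (cmod (y k))\<^sup>2 - 2 * \<omega> * Re (cnj (z p) * (a p k * y k)) + \<omega>\<^sup>2 * (cmod (z p))\<^sup>2 * (cmod (a p k))\<^sup>2" for k
    unfolding cmod_power2 by (simp add: power2_eq_square algebra_simps)
  have "(\<Sum>k<d. (cmod (x k - \<omega> * (\<Sum>j<Suc p. cnj (a j k) * z j)))\<^sup>2) =
    (\<Sum>k<d. (cmod (y k - \<omega> * (cnj (a p k) * z p)))\<^sup>2)"
    by (simp add: y_def algebra_simps)
  also have "\<dots> = (\<Sum>k<d. (cmod (y k))\<^sup>2) - 2 * \<omega> * Re (cnj (z p) * (\<Sum>k<d. a p k * y k))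
      + \<omega>\<^sup>2 * (cmod (z p))\<^sup>2 * s p"
    unfolding sq s_def sum.distrib sum_subtractf by (simp only: sum_distrib_left Re_sum)
  also have "Re (cnj (z p) * (\<Sum>k<d. a p k * y k)) = s p * (cmod (z p))\<^sup>2"
    unfolding ay cmod_power2 by (simp add: power2_eq_square algebra_simps)
  also have "(\<Sum>k<d. (cmod (y k))\<^sup>2) =
    (\<Sum>k<d. (cmod (x k))\<^sup>2) - \<omega> * (2 - \<omega>) * (\<Sum>i<p. s i * (cmod (z i))\<^sup>2)"
    unfolding y_def using Suc by auto
  finally show ?case by (simp add: algebra_simps power2_eq_square)
qed

text \<open>The triangle inequality is followed by the fact that the weighted variance of the moduli
  about their mean \<open>m\<close> is nonnegative.\<close>

lemma cmod_convex_sum_power2_le: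
  fixes c :: "'b \<Rightarrow> complex" and w :: "'b \<Rightarrow> real"
  assumes "finite A" "\<And>i. i \<in> A \<Longrightarrow> w i \<ge> 0" "sum w A = 1"
  shows "(cmod (\<Sum>i\<in>A. w i * c i))\<^sup>2 \<le> (\<Sum>i\<in>A. w i * (cmod (c i))\<^sup>2)"
proof -
  have "cmod (\<Sum>i\<in>A. w i * c i) \<le> (\<Sum>i\<in>A. w i * cmod (c i))"
    by (rule order_trans[OF norm_sum]) (simp add: norm_mult assms)
  hence "(cmod (\<Sum>i\<in>A. w i * c i))\<^sup>2 \<le> (\<Sum>i\<in>A. w i * cmod (c i))\<^sup>2"
    by (rule power_mono) simp
  also have "\<dots> \<le> (\<Sum>i\<in>A. w i * (cmod (c i))\<^sup>2)"
  proof -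
    define m where "m = (\<Sum>i\<in>A. w i * cmod (c i))"
    have "0 \<le> (\<Sum>i\<in>A. w i * (cmod (c i) - m)\<^sup>2)"
      by (intro sum_nonneg mult_nonneg_nonneg assms) auto
    also have "\<dots> = (\<Sum>i\<in>A. w i * (cmod (c i))\<^sup>2) - 2 * m * (\<Sum>i\<in>A. w i * cmod (c i))
        + m\<^sup>2 * sum w A"
      by (simp add: power2_diff algebra_simps sum.distrib sum_subtractf sum_distrib_left sum_distrib_right)
    finally show ?thesis
      unfolding assms(3) m_def[symmetric] by (simp add: power2_eq_square)
  qed
  finally show ?thesis .
qed

section \<open>Block diagonal matrices and the splitting of block systems\<close>

lemma det_diag_block_mat:
  fixes As :: "'a :: idom mat list"
  assumes "\<And>A. A \<in> set As \<Longrightarrow> square_mat A"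
  shows "det (diag_block_mat As) = prod_list (map det As)"
  using assms
proof (induction As)
  case (Cons A As)
  have "square_mat (diag_block_mat As)"
    using Cons.prems by (intro diag_block_mat_square) auto
  hence "det (diag_block_mat (A # As)) = det A * det (diag_block_mat As)"
    unfolding diag_block_mat.simps Let_def using Cons.prems
    by (intro det_four_block_mat_upper_right_zero) auto
  with Cons show ?case by simp
qed simp

lemma diag_block_mat_map_carrier:
  assumes "\<And>l. l \<in> set ls \<Longrightarrow> A l \<in> carrier_mat (p l) (q l)"
  shows "diag_block_mat (map A ls) \<in> carrier_mat (sum_list (map p ls)) (sum_list (map q ls))"
  using assms by (induction ls) (auto simp: Let_def intro!: four_block_carrier_mat)

lemma diag_block_mat_add_smult:
  assumes "\<And>l. l \<in> set ls \<Longrightarrow> A l \<in> carrier_mat (p l) (p l)"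
    and "\<And>l. l \<in> set ls \<Longrightarrow> B l \<in> carrier_mat (p l) (p l)"
  shows "diag_block_mat (map A ls) + c \<cdot>\<^sub>m diag_block_mat (map B ls) =
    diag_block_mat (map (\<lambda>l. A l + c \<cdot>\<^sub>m B l) ls :: 'a :: comm_ring_1 mat list)"
  using assms
proof (induction ls)
  case Nil
  then show ?case by (intro eq_matI) auto
next
  case (Cons l ls)
  define n where "n = sum_list (map p ls)"
  have carr: "diag_block_mat (map A ls) \<in> carrier_mat n n"
    "diag_block_mat (map B ls) \<in> carrier_mat n n"
    unfolding n_def using Cons.prems by (auto intro!: diag_block_mat_map_carrier)
  have AB: "A l \<in> carrier_mat (p l) (p l)" "B l \<in> carrier_mat (p l) (p l)"
    using Cons.prems by auto
  have "diag_block_mat (map (\<lambda>l. A l + c \<cdot>\<^sub>m B l) ls) =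
      diag_block_mat (map A ls) + c \<cdot>\<^sub>m diag_block_mat (map B ls)"
    using Cons by simp
  thus ?case
    unfolding list.map diag_block_mat.simps Let_def using carr AB
    by (intro eq_matI) auto
qed

lemma mat_of_rows_append_mult_vec:
  assumes "x \<in> carrier_vec d"
  shows "mat_of_rows d (xs @ ys) *\<^sub>v x = (mat_of_rows d xs *\<^sub>v x) @\<^sub>v (mat_of_rows d ys *\<^sub>v x)"
  using assms by (intro eq_vecI) (auto simp: nth_append scalar_prod_def row_def mat_of_rows_index intro!: sum.cong)

lemma diag_block_mat_Cons_mult_vec:
  assumes "A \<in> carrier_mat n n" "diag_block_mat As \<in> carrier_mat m m"
    and "u \<in> carrier_vec n" "v \<in> carrier_vec m"
  shows "diag_block_mat (A # As) *\<^sub>v (u @\<^sub>v v) = (A *\<^sub>v u) @\<^sub>v (diag_block_mat As *\<^sub>v v)"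
  using mult_mat_vec_split[OF assms] assms by (simp add: Let_def)

text \<open>The block system \<open>(D + \<omega>L) y = W S x\<close> splits into the systems of the single leaves, from
  whose right-hand sides the leaf weights are pulled out.\<close>

lemma diag_block_mat_solution:
  fixes M :: "'b \<Rightarrow> complex mat" and a :: "'b \<Rightarrow> complex vec list" and w :: "'b \<Rightarrow> complex"
  assumes "\<And>l. l \<in> set ls \<Longrightarrow> M l \<in> carrier_mat (length (a l)) (length (a l))"
    and "\<And>l. l \<in> set ls \<Longrightarrow> w l \<noteq> 0"
    and "distinct ls"
    and x: "x \<in> carrier_vec d"
    and "y \<in> carrier_vec (length (concat (map a ls)))"
    and "diag_block_mat (map M ls) *\<^sub>v y =
      diag_block_mat (map (\<lambda>l. w l \<cdot>\<^sub>m 1\<^sub>m (length (a l))) ls) *\<^sub>v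
        (mat_of_rows d (concat (map a ls)) *\<^sub>v x)"
  shows "\<exists>z. (\<forall>l\<in>set ls. z l \<in> carrier_vec (length (a l)) \<and>
        M l *\<^sub>v z l = mat_of_rows d (a l) *\<^sub>v x) \<and>
      (\<forall>k. (\<Sum>i<dim_vec y. cnj (concat (map a ls) ! i $ k) * y $ i) =
        (\<Sum>l\<in>set ls. w l * (\<Sum>j<length (a l). cnj (a l ! j $ k) * z l $ j)))"
  using assms(1-3,5-)
proof (induction ls arbitrary: y)
  case Nil
  then show ?case by simp
next
  case (Cons l ls)
  let ?p = "length (a l)" and ?n = "length (concat (map a ls))"
  let ?W = "\<lambda>l. w l \<cdot>\<^sub>m (1\<^sub>m (length (a l)) :: complex mat)"
  define u v where "u = vec_first y ?p" and "v = vec_last y ?n"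
  have uv: "u \<in> carrier_vec ?p" "v \<in> carrier_vec ?n" and y: "y = u @\<^sub>v v"
    using Cons.prems(4) by (auto simp: u_def v_def)
  have carr: "diag_block_mat (map M ls) \<in> carrier_mat ?n ?n" "M l \<in> carrier_mat ?p ?p"
     "diag_block_mat (map ?W ls) \<in> carrier_mat ?n ?n" "?W l \<in> carrier_mat ?p ?p"
    using Cons.prems(1)
    by (auto simp: length_concat comp_def intro!: diag_block_mat_map_carrier)
  define r where "r = mat_of_rows d (concat (map a ls)) *\<^sub>v x"
  define s where "s = mat_of_rows d (a l) *\<^sub>v x"
  have rs: "r \<in> carrier_vec ?n" "s \<in> carrier_vec ?p"
    unfolding r_def s_def carrier_vec_def by simp_all
  have "(M l *\<^sub>v u) @\<^sub>v (diag_block_mat (map M ls) *\<^sub>v v) =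
      (?W l *\<^sub>v s) @\<^sub>v (diag_block_mat (map ?W ls) *\<^sub>v r)"
    using Cons.prems(5) diag_block_mat_Cons_mult_vec[OF carr(2,1) uv]
      diag_block_mat_Cons_mult_vec[OF carr(4,3) rs(2,1)]
    by (simp only: y list.map concat.simps mat_of_rows_append_mult_vec[OF x] r_def s_def)
  moreover have "M l *\<^sub>v u \<in> carrier_vec ?p" "?W l *\<^sub>v s \<in> carrier_vec ?p"
    using mult_mat_vec_carrier[OF carr(2) uv(1)] mult_mat_vec_carrier[OF carr(4) rs(2)] .
  ultimately have eqs: "M l *\<^sub>v u = ?W l *\<^sub>v s" "diag_block_mat (map M ls) *\<^sub>v v = diag_block_mat (map ?W ls) *\<^sub>v r"
    by (simp_all only: append_vec_eq)
  from Cons.IH[of v] obtain z where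
    z: "\<forall>l\<in>set ls. z l \<in> carrier_vec (length (a l)) \<and> M l *\<^sub>v z l = mat_of_rows d (a l) *\<^sub>v x"
    and zs: "\<And>k. (\<Sum>i<dim_vec v. cnj (concat (map a ls) ! i $ k) * v $ i) =
        (\<Sum>l\<in>set ls. w l * (\<Sum>j<length (a l). cnj (a l ! j $ k) * z l $ j))"
    using Cons.prems eqs(2) uv by (auto simp: r_def)
  \<comment> \<open>The first block \<open>u\<close> solves the system of \<open>l\<close> with its
    right-hand side multiplied by \<open>w l\<close>. Dividing by \<open>w l\<close> removes this
    factor, which reappears in front of the sum for \<open>l\<close>. The solutions for the leaves
    in \<open>ls\<close> stay untouched because \<open>l\<close> does not occur there.\<close>
  define z' where "z' = z(l := (1 / w l) \<cdot>\<^sub>v u)"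
  have w: "w l \<noteq> 0" and l: "l \<notin> set ls" using Cons.prems by auto
  have "M l *\<^sub>v ((1 / w l) \<cdot>\<^sub>v u) = (1 / w l) \<cdot>\<^sub>v (?W l *\<^sub>v s)"
    using eqs(1) carr(2) uv by (simp add: mult_mat_vec)
  also have "?W l *\<^sub>v s = w l \<cdot>\<^sub>v s"
    using rs by (intro eq_vecI) auto
  also have "(1 / w l) \<cdot>\<^sub>v (w l \<cdot>\<^sub>v s) = s" using w by (simp add: smult_smult_assoc)
  finally have Ml: "M l *\<^sub>v ((1 / w l) \<cdot>\<^sub>v u) = s" .
  have "(\<Sum>i<dim_vec y. cnj (concat (map a (l # ls)) ! i $ k) * y $ i) =
        (\<Sum>l\<in>set (l # ls). w l * (\<Sum>j<length (a l). cnj (a l ! j $ k) * z' l $ j))" for k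
  proof -
    have "(\<Sum>i<dim_vec y. cnj (concat (map a (l # ls)) ! i $ k) * y $ i) =
        (\<Sum>i<?p + ?n. cnj ((a l @ concat (map a ls)) ! i $ k) * (u @\<^sub>v v) $ i)"
      using uv by (simp add: y)
    also have "\<dots> = (\<Sum>i<?p. cnj (a l ! i $ k) * u $ i) +
        (\<Sum>i<?n. cnj (concat (map a ls) ! i $ k) * v $ i)"
      using uv unfolding sum.atLeastLessThan_concat[of 0 ?p "?p + ?n", simplified, symmetric] lessThan_atLeast0
        sum.shift_bounds_nat_ivl[of _ 0 ?p ?n, simplified add.commute, simplified]
      by (intro arg_cong2[of _ _ _ _ "(+)"] sum.cong) (auto simp: nth_append)
    also have "(\<Sum>i<?n. cnj (concat (map a ls) ! i $ k) * v $ i) =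
        (\<Sum>l\<in>set ls. w l * (\<Sum>j<length (a l). cnj (a l ! j $ k) * z' l $ j))"
      using zs[of k] uv l by (simp add: z'_def) (rule sum.cong, auto)
    also have "(\<Sum>i<?p. cnj (a l ! i $ k) * u $ i) = w l * (\<Sum>j<?p. cnj (a l ! j $ k) * z' l $ j)"
      using uv w by (simp add: z'_def sum_distrib_left)
    finally show ?thesis using l by simp
  qed
  moreover have "\<forall>l\<in>set (l # ls). z' l \<in> carrier_vec (length (a l)) \<and>
      M l *\<^sub>v z' l = mat_of_rows d (a l) *\<^sub>v x"
    using z Ml uv l by (auto simp: z'_def s_def)
  ultimately show ?case by blast
qed

section \<open>Adjoints, inverses, limits of complex vectors and affine fixed points\<close>

lemma mat_adjoint_carrier:
  "A \<in> carrier_mat nr nc \<Longrightarrow> mat_adjoint A \<in> carrier_mat nc nr"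
  by (auto simp: mat_adjoint_def)

lemma index_mat_adjoint:
  "i < dim_col A \<Longrightarrow> j < dim_row A \<Longrightarrow> mat_adjoint A $$ (i, j) = conjugate (A $$ (j, i))"
  by (auto simp: mat_adjoint_def mat_of_rows_index)

text \<open>A nonzero determinant makes \<open>A\<close> a unit of the matrix ring, which rules out
  the value \<open>None\<close>.\<close>

lemma mat_inverse_det_nonzero:
  fixes A :: "'a :: field mat"
  assumes A: "A \<in> carrier_mat n n" and "det A \<noteq> 0"
  shows "the (mat_inverse A) \<in> carrier_mat n n" "A * the (mat_inverse A) = 1\<^sub>m n"
proof -
  have "mat_inverse A \<noteq> None"
    using mat_inverse(1)[OF A, where b = "()"] det_non_zero_imp_unit[OF assms, where b = "()"] by blast
  then obtain B where "mat_inverse A = Some B" by blast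
  with mat_inverse(2)[OF A this] show "the (mat_inverse A) \<in> carrier_mat n n"
    "A * the (mat_inverse A) = 1\<^sub>m n" by auto
qed

text \<open>The Euclidean norm is at most the sum of the moduli of the entries, and each entry of
  the product is at most \<open>b\<close> times that sum for \<open>v\<close>. This crude constant
  suffices, since only the dependence on \<open>b\<close> affects the rate.\<close>

lemma cvec_norm_mult_mat_vec_le:
  assumes A: "A \<in> carrier_mat n n" and v: "v \<in> carrier_vec n" and b: "norm_bound A b"
  shows "cvec_norm (A *\<^sub>v v) \<le> n * (\<Sum>j<n. cmod (v $ j)) * b"
proof -
  have "cvec_norm (A *\<^sub>v v) \<le> (\<Sum>i<n. cmod ((A *\<^sub>v v) $ i))"
    using A L2_set_le_sum[of "{..<n}" "\<lambda>i. cmod ((A *\<^sub>v v) $ i)"]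
    by (simp add: cvec_norm_def del: index_mult_mat_vec)
  also have "\<dots> \<le> (\<Sum>i<n. \<Sum>j<n. b * cmod (v $ j))"
  proof (rule sum_mono)
    fix i assume i: "i \<in> {..<n}"
    hence "(A *\<^sub>v v) $ i = (\<Sum>j<n. A $$ (i, j) * v $ j)"
      using A v by (auto simp: scalar_prod_def lessThan_atLeast0)
    also have "cmod \<dots> \<le> (\<Sum>j<n. cmod (A $$ (i, j) * v $ j))" by (rule norm_sum)
    also have "\<dots> \<le> (\<Sum>j<n. b * cmod (v $ j))"
      using A b i by (auto simp: norm_mult norm_bound_def intro!: sum_mono mult_right_mono)
    finally show "cmod ((A *\<^sub>v v) $ i) \<le> (\<Sum>j<n. b * cmod (v $ j))" .
  qed
  finally show ?thesis by (simp add: sum_distrib_left[symmetric] mult_ac)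
qed

lemma cvec_tendsto_index:
  assumes lim: "cvec_tendsto x y" and x: "\<And>n. x n \<in> carrier_vec d" and y: "y \<in> carrier_vec d"
    and i: "i < d"
  shows "(\<lambda>n. x n $ i) \<longlonglongrightarrow> y $ i"
proof (rule metric_tendsto_imp_tendsto)
  show "(\<lambda>n. cvec_norm (x n - y)) \<longlonglongrightarrow> 0"
    using lim by (simp add: cvec_tendsto_def)
  have "cmod ((x n - y) $ i) \<le> cvec_norm (x n - y)" for n
    unfolding cvec_norm_def using i y by (intro member_le_L2_set) auto
  thus "\<forall>\<^sub>F n in sequentially. dist (x n $ i) (y $ i) \<le> dist (cvec_norm (x n - y)) 0"
    using i y by (intro always_eventually) (auto simp: dist_norm intro: order_trans[OF _ abs_ge_self])
qed

lemma cvec_tendsto_unique: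
  assumes "cvec_tendsto x y" "cvec_tendsto x y'" and "\<And>n. x n \<in> carrier_vec d"
    and "y \<in> carrier_vec d" "y' \<in> carrier_vec d"
  shows "y = y'"
  using assms
  by (intro eq_vecI) (auto intro!: LIMSEQ_unique[OF cvec_tendsto_index cvec_tendsto_index])

lemma add_diff_cancel_right_vec:
  fixes u v w :: "'a :: ab_group_add vec"
  assumes "u \<in> carrier_vec n" "v \<in> carrier_vec n" "w \<in> carrier_vec n"
  shows "(u + w) - (v + w) = u - v"
  using assms by (intro eq_vecI) auto

text \<open>Powers are defined by multiplication on the right, whereas the error of the iteration is
  multiplied by \<open>A\<close> from the left.\<close>

lemma pow_mat_Suc_left:
  assumes A: "A \<in> carrier_mat n n"
  shows "A ^\<^sub>m Suc k = A * A ^\<^sub>m k"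
proof (induction k)
  case 0
  show ?case using A by simp
next
  case (Suc k)
  have "A * A ^\<^sub>m Suc k = A * A ^\<^sub>m k * A"
    using assoc_mult_mat[OF A pow_carrier_mat[OF A] A] by simp
  thus ?case using Suc by simp
qed

text \<open>A spectral radius below 1 excludes the eigenvalue 1. Hence
  \<open>1\<^sub>m n - A\<close> is invertible, and its inverse applied to \<open>b\<close> is the
  fixed point.\<close>

lemma affine_fixed_point:
  fixes A :: "complex mat"
  assumes A: "A \<in> carrier_mat n n" and n: "n > 0" and sr: "spectral_radius A < 1"
    and b: "b \<in> carrier_vec n"
  shows "\<exists>x \<in> carrier_vec n. x = A *\<^sub>v x + b"
proof -
  have IA: "1\<^sub>m n - A \<in> carrier_mat n n" using A by auto
  have IAv: "(1\<^sub>m n - A) *\<^sub>v v = v - A *\<^sub>v v" if "v \<in> carrier_vec n" for v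
    using minus_mult_distrib_mat_vec[OF one_carrier_mat A that] that by simp
  have "det (1\<^sub>m n - A) \<noteq> 0"
  proof
    assume "det (1\<^sub>m n - A) = 0"
    then obtain v where v: "v \<in> carrier_vec n" "v \<noteq> 0\<^sub>v n" "(1\<^sub>m n - A) *\<^sub>v v = 0\<^sub>v n"
      using det_0_iff_vec_prod_zero[OF IA] by blast
    have Av: "A *\<^sub>v v \<in> carrier_vec n" by (rule mult_mat_vec_carrier[OF A v(1)])
    have "A *\<^sub>v v = 1 \<cdot>\<^sub>v v"
    proof (rule eq_vecI)
      fix i assume "i < dim_vec (1 \<cdot>\<^sub>v v)"
      hence i: "i < n" using v by simp
      have "v - A *\<^sub>v v = 0\<^sub>v n" using IAv[OF v(1)] v(3) by simp
      hence "(v - A *\<^sub>v v) $ i = 0" using i by (simp only: index_zero_vec)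
      thus "(A *\<^sub>v v) $ i = (1 \<cdot>\<^sub>v v) $ i" using i v(1) A by (simp del: index_mult_mat_vec)
    qed (use v A in auto)
    hence "eigenvalue A 1" using v A by (auto simp: eigenvalue_def eigenvector_def)
    hence "cmod 1 \<le> spectral_radius A"
      by (intro spectral_radius_mem_max(2)[OF A n] imageI) (simp add: spectrum_def)
    with sr show False by simp
  qed
  note inv = mat_inverse_det_nonzero[OF IA this]
  define x where "x = the (mat_inverse (1\<^sub>m n - A)) *\<^sub>v b"
  have x: "x \<in> carrier_vec n" unfolding x_def by (rule mult_mat_vec_carrier[OF inv(1) b])
  have Ax: "A *\<^sub>v x \<in> carrier_vec n" by (rule mult_mat_vec_carrier[OF A x])
  have "x - A *\<^sub>v x = b"
    unfolding IAv[OF x, symmetric]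
    unfolding x_def assoc_mult_mat_vec[OF IA inv(1) b, symmetric] inv(2) using b by simp
  moreover have "A *\<^sub>v x + (x - A *\<^sub>v x) = x"
    using x A by (intro eq_vecI) auto
  ultimately show ?thesis using x by metis
qed

context kaczmarz_tree
begin

section \<open>Depth, induction and path weights in the tree\<close>

lemma depth_Suc_parent:
  assumes "v \<in> nodes T" "v \<noteq> tree_root T"
  shows "depth T v = Suc (depth T (parent T v))"
proof -
  obtain k where "(parent T ^^ k) v = tree_root T" using reaches_root[OF assms(1)] by auto
  from Least_Suc[of "\<lambda>k. (parent T ^^ k) v = tree_root T", OF this]
  show ?thesis using assms(2) by (simp add: depth_def funpow_Suc_right del: funpow.simps(2))
qed

lemma depth_root [simp]: "depth T (tree_root T) = 0"
  unfolding depth_def by (rule Least_equality) auto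

lemma path_weight_Suc_parent:
  assumes "v \<in> nodes T" "v \<noteq> tree_root T"
  shows "path_weight T v = weight T v (parent T v) * path_weight T (parent T v)"
  unfolding path_weight_def depth_Suc_parent[OF assms] prod.lessThan_Suc_shift
  by (simp add: funpow_swap1)

text \<open>Passing to the parent lowers the depth by one, so induction on the depth proceeds from
  the root downwards.\<close>

lemma nodes_induct [consumes 1, case_names root child]:
  assumes "v \<in> nodes T" and "P (tree_root T)"
    and "\<And>v. v \<in> nodes T \<Longrightarrow> v \<noteq> tree_root T \<Longrightarrow> P (parent T v) \<Longrightarrow> P v"
  shows "P v"
  using assms(1)
proof (induction "depth T v" arbitrary: v rule: less_induct)
  case less
  show ?case
  proof (cases "v = tree_root T")
    case False
    have "P (parent T v)"
      using less.prems False by (intro less.hyps) (simp_all add: depth_Suc_parent parent_in_nodes)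
    thus ?thesis by (rule assms(3)[OF less.prems False])
  qed (simp add: assms(2))
qed

text \<open>By minimality of the depth, no earlier iterate is the root. The bound on
  \<open>k\<close> matters because the parent of the root is arbitrary and may lie outside the
  tree.\<close>

lemma funpow_parent_in_nodes:
  "v \<in> nodes T \<Longrightarrow> k \<le> depth T v \<Longrightarrow> (parent T ^^ k) v \<in> nodes T"
proof (induction k)
  case (Suc k)
  hence "(parent T ^^ k) v \<noteq> tree_root T"
    unfolding depth_def by (metis Suc_le_lessD not_less_Least)
  with Suc show ?case by (simp add: parent_in_nodes)
qed simp

lemma set_root_path: "v \<in> nodes T \<Longrightarrow> set (root_path T v) \<subseteq> nodes T"
  by (auto simp: root_path_def intro!: funpow_parent_in_nodes simp del: upt_Suc)

lemma path_weight_pos: "v \<in> nodes T \<Longrightarrow> path_weight T v > 0"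
proof (induction rule: nodes_induct)
  case (child v)
  thus ?case
    by (simp add: path_weight_Suc_parent weight_pos parent_in_nodes children_def)
qed (simp add: path_weight_def)

text \<open>Each inner node has the weight of its children together, so summing over all inner nodes
  counts every node but the root.\<close>

lemma sum_path_weight_leaves: "(\<Sum>l\<in>leaves T. path_weight T l) = 1"
proof -
  define N where "N = nodes T - leaves T"
  have fin: "finite N" "finite (leaves T)" "\<And>v. finite (children T v)"
    using finite_nodes by (auto simp: N_def leaves_def children_def)
  have "path_weight T v = (\<Sum>u\<in>children T v. path_weight T u)" if v: "v \<in> N" for v
  proof -
    have "(\<Sum>u\<in>children T v. path_weight T u) = (\<Sum>u\<in>children T v. weight T u v * path_weight T v)"
      by (rule sum.cong) (auto simp: children_def path_weight_Suc_parent)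
    also have "\<dots> = path_weight T v"
      using v weight_sum[of v] by (simp add: sum_distrib_right[symmetric] N_def)
    finally show ?thesis by simp
  qed
  hence "(\<Sum>v\<in>N. path_weight T v) = (\<Sum>v\<in>N. \<Sum>u\<in>children T v. path_weight T u)"
    by (intro sum.cong) auto
  \<comment> \<open>Different nodes have disjoint sets of children, since each child determines its
    parent.\<close>
  also have "\<dots> = sum (path_weight T) (\<Union>v\<in>N. children T v)"
    using fin by (subst sum.UNION_disjoint) (auto simp: children_def)
  also have "(\<Union>v\<in>N. children T v) = nodes T - {tree_root T}"
    using parent_in_nodes by (auto simp: N_def leaves_def children_def)
  also have "sum (path_weight T) \<dots> = sum (path_weight T) (nodes T) - path_weight T (tree_root T)"
    using finite_nodes root_in_nodes by (simp add: sum_diff1)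
  \<comment> \<open>The sums over the inner nodes now cancel. What remains equates the sum over the
    leaves with the weight of the root, which is an empty product. A root that is itself a leaf is
    covered as well.\<close>
  also have "sum (path_weight T) (nodes T) = sum (path_weight T) N + sum (path_weight T) (leaves T)"
    using finite_nodes unfolding N_def by (intro sum.subset_diff) (auto simp: leaves_def)
  finally show ?thesis by (simp add: path_weight_def)
qed

section \<open>The stacked matrices and the invertible triangular blocks\<close>

abbreviation "d \<equiv> space_dim T"

abbreviation "path_coefs l \<equiv> map (coef T) (root_path T l)"

abbreviation "all_coefs \<equiv> concat (map path_coefs (leaf_list T))"

lemma leaf_in_nodes: "l \<in> set (leaf_list T) \<Longrightarrow> l \<in> nodes T"
  by (auto simp: leaf_list_set leaves_def)

lemma path_coefs_carrier:
  "l \<in> set (leaf_list T) \<Longrightarrow> set (path_coefs l) \<subseteq> carrier_vec d"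
  using set_root_path[OF leaf_in_nodes] coef_carrier by auto

lemma S_mat_eq: "S_mat T = mat_of_rows d all_coefs"
proof -
  have "map (\<lambda>l. rows (S_leaf T l)) (leaf_list T) = map path_coefs (leaf_list T)"
    using path_coefs_carrier by (intro map_cong) (auto simp: S_leaf_def)
  thus ?thesis by (simp only: S_mat_def)
qed

lemma S_mat_carrier: "S_mat T \<in> carrier_mat (length all_coefs) d"
  unfolding S_mat_eq by (rule mat_of_rows_carrier)

lemma S_adj_carrier: "mat_adjoint (S_mat T) \<in> carrier_mat d (length all_coefs)"
  by (rule mat_adjoint_carrier[OF S_mat_carrier])

lemma S_adj_mult_vec_index:
  assumes "k < d" "u \<in> carrier_vec (length all_coefs)"
  shows "(mat_adjoint (S_mat T) *\<^sub>v u) $ k = (\<Sum>i<dim_vec u. cnj (all_coefs ! i $ k) * u $ i)"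
proof -
  have "(mat_adjoint (S_mat T) *\<^sub>v u) $ k =
      (\<Sum>i<dim_vec u. mat_adjoint (S_mat T) $$ (k, i) * u $ i)"
    using assms S_adj_carrier by (auto simp: scalar_prod_def lessThan_atLeast0)
  also have "\<dots> = (\<Sum>i<dim_vec u. cnj (all_coefs ! i $ k) * u $ i)"
    using assms S_mat_carrier by (intro sum.cong) (auto simp: index_mat_adjoint S_mat_eq mat_of_rows_index)
  finally show ?thesis .
qed

lemma W_mat_carrier: "W_mat T \<in> carrier_mat (length all_coefs) (length all_coefs)"
  unfolding W_mat_def length_concat map_map comp_def
  by (rule diag_block_mat_map_carrier) (simp add: W_leaf_def)

definition "DL_leaf \<omega> l = D_leaf T l + complex_of_real \<omega> \<cdot>\<^sub>m L_leaf T l"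

lemma DL_leaf_carrier: "DL_leaf \<omega> l \<in> carrier_mat (length (path_coefs l)) (length (path_coefs l))"
  by (simp add: DL_leaf_def D_leaf_def L_leaf_def Let_def)

lemma sq_norm_coef_pos:
  assumes "l \<in> set (leaf_list T)" "i < length (path_coefs l)"
  shows "(\<Sum>k<d. (cmod (path_coefs l ! i $ k))\<^sup>2) > 0"
proof -
  have v: "root_path T l ! i \<in> nodes T"
    using set_root_path[OF leaf_in_nodes[OF assms(1)]] assms(2) nth_mem by fastforce
  then obtain k where "k < d" "path_coefs l ! i $ k \<noteq> 0"
    using coef_nonzero[OF v] coef_carrier[OF v] assms(2)
    by (metis carrier_vecD eq_vecI index_zero_vec length_map nth_map)
  thus ?thesis by (intro sum_pos2[of _ k]) auto
qed

lemma index_DL_leaf: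
  assumes "l \<in> set (leaf_list T)" "i < length (path_coefs l)" "j < length (path_coefs l)"
  shows "DL_leaf \<omega> l $$ (i, j) =
    (if j = i then complex_of_real (\<Sum>k<d. (cmod (path_coefs l ! i $ k))\<^sup>2) else 0) +
    (if j < i then \<omega> * (\<Sum>k<d. path_coefs l ! i $ k * cnj (path_coefs l ! j $ k)) else 0)"
proof -
  have "path_coefs l ! j \<in> carrier_vec d"
    using path_coefs_carrier[OF assms(1)] nth_mem[OF assms(3)] by blast
  thus ?thesis using assms
    by (auto simp: DL_leaf_def D_leaf_def L_leaf_def Let_def scalar_prod_def lessThan_atLeast0
        complex_norm_square[symmetric])
qed

text \<open>The block is lower triangular, and its diagonal consists of squared norms of nonzero
  vectors, whatever \<open>\<omega>\<close> is.\<close>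

lemma det_DL_leaf: "l \<in> set (leaf_list T) \<Longrightarrow> det (DL_leaf \<omega> l) \<noteq> 0"
proof -
  assume l: "l \<in> set (leaf_list T)"
  have "det (DL_leaf \<omega> l) = prod_list (diag_mat (DL_leaf \<omega> l))"
    using l by (intro det_lower_triangular[OF _ DL_leaf_carrier]) (simp add: index_DL_leaf)
  moreover have "DL_leaf \<omega> l $$ (i, i) \<noteq> 0" if "i < length (path_coefs l)" for i
    using sq_norm_coef_pos[OF l that] unfolding index_DL_leaf[OF l that that]
    by (simp del: of_real_sum)
  ultimately show ?thesis
    using DL_leaf_carrier[of \<omega> l] by (auto simp: diag_mat_def)
qed

lemma DL_mat_eq:
  "D_mat T + complex_of_real \<omega> \<cdot>\<^sub>m L_mat T = diag_block_mat (map (DL_leaf \<omega>) (leaf_list T))"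
  unfolding D_mat_def L_mat_def DL_leaf_def
  by (rule diag_block_mat_add_smult[where p = "\<lambda>l. length (root_path T l)"])
    (auto simp: D_leaf_def L_leaf_def Let_def)

lemma DL_mat_carrier:
  "diag_block_mat (map (DL_leaf \<omega>) (leaf_list T)) \<in> carrier_mat (length all_coefs) (length all_coefs)"
  unfolding length_concat map_map comp_def
  by (rule diag_block_mat_map_carrier, rule DL_leaf_carrier)

text \<open>The determinant is the product of the nonzero determinants of the blocks, so
  \<open>the\<close> in \<open>DL_inv\<close> is applied to an actual inverse.\<close>

lemma DL_inv:
  shows DL_inv_carrier: "DL_inv T \<omega> \<in> carrier_mat (length all_coefs) (length all_coefs)"
    and DL_mult_inv: "diag_block_mat (map (DL_leaf \<omega>) (leaf_list T)) * DL_inv T \<omega> = 1\<^sub>m (length all_coefs)"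
proof -
  have "det (diag_block_mat (map (DL_leaf \<omega>) (leaf_list T))) \<noteq> 0"
    using det_DL_leaf carrier_matD[OF DL_leaf_carrier]
    by (subst det_diag_block_mat) auto
  from mat_inverse_det_nonzero[OF DL_mat_carrier this]
  show "DL_inv T \<omega> \<in> carrier_mat (length all_coefs) (length all_coefs)"
    "diag_block_mat (map (DL_leaf \<omega>) (leaf_list T)) * DL_inv T \<omega> = 1\<^sub>m (length all_coefs)"
    unfolding DL_inv_def DL_mat_eq by auto
qed

section \<open>The iteration matrix as a weighted average of sweeps\<close>

lemma B_mat_carrier: "B_mat T \<omega> \<in> carrier_mat d d"
  using S_mat_carrier S_adj_carrier by (auto simp: B_mat_def)

text \<open>Bracketing from the right exposes the solution of the block triangular system with
  right-hand side \<open>W_mat T *\<^sub>v (S_mat T *\<^sub>v x)\<close> as a vector of its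
  own.\<close>

lemma B_mat_mult_vec:
  assumes x: "x \<in> carrier_vec d"
  shows "B_mat T \<omega> *\<^sub>v x = x - complex_of_real \<omega> \<cdot>\<^sub>v
    (mat_adjoint (S_mat T) *\<^sub>v (DL_inv T \<omega> *\<^sub>v (W_mat T *\<^sub>v (S_mat T *\<^sub>v x))))"
proof -
  let ?n = "length all_coefs"
  note c = S_mat_carrier S_adj_carrier W_mat_carrier DL_inv_carrier[of \<omega>]
  have c1: "mat_adjoint (S_mat T) * DL_inv T \<omega> \<in> carrier_mat d ?n"
    "mat_adjoint (S_mat T) * DL_inv T \<omega> * W_mat T \<in> carrier_mat d ?n"
    "mat_adjoint (S_mat T) * DL_inv T \<omega> * W_mat T * S_mat T \<in> carrier_mat d d"
    using c by (auto intro!: mult_carrier_mat[of _ _ ?n])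
  have "(1\<^sub>m d - complex_of_real \<omega> \<cdot>\<^sub>m Q) *\<^sub>v x = x - complex_of_real \<omega> \<cdot>\<^sub>v (Q *\<^sub>v x)"
    if "Q \<in> carrier_mat d d" for Q
    using that x by (simp add: minus_mult_distrib_mat_vec[of _ d d] smult_mat_mult_vec)
  from this[OF c1(3)] have "B_mat T \<omega> *\<^sub>v x = x - complex_of_real \<omega> \<cdot>\<^sub>v
      ((mat_adjoint (S_mat T) * DL_inv T \<omega> * W_mat T * S_mat T) *\<^sub>v x)"
    by (simp only: B_mat_def)
  also have "(mat_adjoint (S_mat T) * DL_inv T \<omega> * W_mat T * S_mat T) *\<^sub>v x =
      mat_adjoint (S_mat T) *\<^sub>v (DL_inv T \<omega> *\<^sub>v (W_mat T *\<^sub>v (S_mat T *\<^sub>v x)))"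
  proof -
    have Sx: "S_mat T *\<^sub>v x \<in> carrier_vec ?n" by (rule mult_mat_vec_carrier[OF c(1) x])
    have WSx: "W_mat T *\<^sub>v (S_mat T *\<^sub>v x) \<in> carrier_vec ?n"
      by (rule mult_mat_vec_carrier[OF c(3) Sx])
    show ?thesis
      by (simp only: assoc_mult_mat_vec[OF c1(2) c(1) x] assoc_mult_mat_vec[OF c1(1) c(3) Sx]
          assoc_mult_mat_vec[OF c(2,4) WSx])
  qed
  finally show ?thesis .
qed

text \<open>The entries of \<open>z l\<close> are the step lengths of one relaxed Kaczmarz sweep from the root
  to \<open>l\<close>.\<close>

lemma B_mat_sweeps:
  assumes x: "x \<in> carrier_vec d"
  obtains z where
    "\<And>l. l \<in> leaves T \<Longrightarrow> z l \<in> carrier_vec (length (path_coefs l))"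
    "\<And>l. l \<in> leaves T \<Longrightarrow> DL_leaf \<omega> l *\<^sub>v z l = mat_of_rows d (path_coefs l) *\<^sub>v x"
    "\<And>k. k < d \<Longrightarrow> (B_mat T \<omega> *\<^sub>v x) $ k = (\<Sum>l\<in>leaves T. path_weight T l *
      (x $ k - \<omega> * (\<Sum>j<length (path_coefs l). cnj (path_coefs l ! j $ k) * z l $ j)))"
proof -
  let ?n = "length all_coefs"
  define w where "w = (\<lambda>l. complex_of_real (path_weight T l))"
  define r where "r = W_mat T *\<^sub>v (S_mat T *\<^sub>v x)"
  define y where "y = DL_inv T \<omega> *\<^sub>v r"
  have r: "r \<in> carrier_vec ?n" and y: "y \<in> carrier_vec ?n"
    unfolding y_def r_def using S_mat_carrier W_mat_carrier DL_inv_carrier[of \<omega>] x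
    by (auto intro!: mult_mat_vec_carrier[of _ ?n ?n] mult_mat_vec_carrier[of _ ?n d])
  have "diag_block_mat (map (DL_leaf \<omega>) (leaf_list T)) *\<^sub>v y =
      diag_block_mat (map (DL_leaf \<omega>) (leaf_list T)) * DL_inv T \<omega> *\<^sub>v r"
    unfolding y_def by (rule assoc_mult_mat_vec[OF DL_mat_carrier DL_inv_carrier r, symmetric])
  also have "\<dots> = r" using r by (simp add: DL_mult_inv)
  also have "\<dots> = diag_block_mat (map (\<lambda>l. w l \<cdot>\<^sub>m 1\<^sub>m (length (path_coefs l))) (leaf_list T)) *\<^sub>v
      (mat_of_rows d all_coefs *\<^sub>v x)"
    by (simp add: r_def W_mat_def W_leaf_def[abs_def] S_mat_eq w_def)
  finally have eq: "diag_block_mat (map (DL_leaf \<omega>) (leaf_list T)) *\<^sub>v y = \<dots>" .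
  have w: "w l \<noteq> 0" if "l \<in> set (leaf_list T)" for l
    using path_weight_pos[OF leaf_in_nodes[OF that]] by (simp add: w_def)
  from diag_block_mat_solution[OF DL_leaf_carrier w leaf_list_distinct x y eq]
  obtain z where z: "\<And>l. l \<in> leaves T \<Longrightarrow> z l \<in> carrier_vec (length (path_coefs l))"
    "\<And>l. l \<in> leaves T \<Longrightarrow> DL_leaf \<omega> l *\<^sub>v z l = mat_of_rows d (path_coefs l) *\<^sub>v x"
    and zs: "\<And>k. (\<Sum>i<dim_vec y. cnj (all_coefs ! i $ k) * y $ i) =
      (\<Sum>l\<in>leaves T. w l * (\<Sum>j<length (path_coefs l). cnj (path_coefs l ! j $ k) * z l $ j))"
    unfolding leaf_list_set by blast
  have "(B_mat T \<omega> *\<^sub>v x) $ k = (\<Sum>l\<in>leaves T. path_weight T l *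
      (x $ k - \<omega> * (\<Sum>j<length (path_coefs l). cnj (path_coefs l ! j $ k) * z l $ j)))"
    if k: "k < d" for k
  proof -
    have "(B_mat T \<omega> *\<^sub>v x) $ k = x $ k - \<omega> * (mat_adjoint (S_mat T) *\<^sub>v y) $ k"
      using k x S_adj_carrier by (simp add: B_mat_mult_vec[OF x] y_def r_def)
    also have "(mat_adjoint (S_mat T) *\<^sub>v y) $ k =
      (\<Sum>l\<in>leaves T. w l * (\<Sum>j<length (path_coefs l). cnj (path_coefs l ! j $ k) * z l $ j))"
      by (simp only: S_adj_mult_vec_index[OF k y] zs)
    \<comment> \<open>Since the leaf weights sum to 1, the identity part of \<open>B_mat\<close> can
      be distributed over the leaves as well, which makes the whole expression an average of
      sweeps.\<close>
    also have "x $ k = (\<Sum>l\<in>leaves T. w l * x $ k)"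
      unfolding w_def sum_distrib_right[symmetric] of_real_sum[symmetric] sum_path_weight_leaves by simp
    finally show ?thesis
      by (simp add: w_def right_diff_distrib sum_subtractf sum_distrib_left mult_ac)
  qed
  with z show thesis by (rule that)
qed

section \<open>Strict decrease of the norm off the kernel of the stacked matrix\<close>

text \<open>Averaging the energy identity over the leaves bounds the squared norm of the image by
  that of \<open>x\<close> minus \<open>\<omega> * (2 - \<omega>)\<close> times the weighted sum of
  the nonnegative losses \<open>E l\<close>. If the norm does not decrease, all losses vanish, hence
  all step lengths \<open>z l\<close> are 0. The leaf systems then give the right-hand side 0, which
  says that every row of \<open>S_mat\<close> annihilates \<open>x\<close>.\<close>

lemma norm_B_mat_ge_imp_kernel_S_mat:
  assumes x: "x \<in> carrier_vec d" and \<omega>: "0 < \<omega>" "\<omega> < 2"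
  assumes ge: "(\<Sum>k<d. (cmod (x $ k))\<^sup>2) \<le> (\<Sum>k<d. (cmod ((B_mat T \<omega> *\<^sub>v x) $ k))\<^sup>2)"
  shows "S_mat T *\<^sub>v x = 0\<^sub>v (length all_coefs)"
proof -
  obtain z where zc: "\<And>l. l \<in> leaves T \<Longrightarrow> z l \<in> carrier_vec (length (path_coefs l))"
    and Mz: "\<And>l. l \<in> leaves T \<Longrightarrow> DL_leaf \<omega> l *\<^sub>v z l = mat_of_rows d (path_coefs l) *\<^sub>v x"
    and Bx: "\<And>k. k < d \<Longrightarrow> (B_mat T \<omega> *\<^sub>v x) $ k = (\<Sum>l\<in>leaves T. path_weight T l *
      (x $ k - \<omega> * (\<Sum>j<length (path_coefs l). cnj (path_coefs l ! j $ k) * z l $ j)))"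
    using B_mat_sweeps[OF x] by blast
  \<comment> \<open>\<open>y l\<close> is the end point of the sweep towards the leaf
    \<open>l\<close>.\<close>
  define y where "y = (\<lambda>l k. x $ k - \<omega> * (\<Sum>j<length (path_coefs l). cnj (path_coefs l ! j $ k) * z l $ j))"
  define s where "s = (\<lambda>l i. \<Sum>k<d. (cmod (path_coefs l ! i $ k))\<^sup>2)"
  define E where "E = (\<lambda>l. \<Sum>i<length (path_coefs l). s l i * (cmod (z l $ i))\<^sup>2)"
  have fin: "finite (leaves T)" using finite_nodes by (simp add: leaves_def)
  have pw: "path_weight T l > 0" if "l \<in> leaves T" for l
    using that by (auto intro: path_weight_pos simp: leaves_def)
  have energy: "(\<Sum>k<d. (cmod (y l k))\<^sup>2) = (\<Sum>k<d. (cmod (x $ k))\<^sup>2) - \<omega> * (2 - \<omega>) * E l"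
    if l: "l \<in> leaves T" for l
    unfolding y_def E_def s_def
  proof (rule kaczmarz_sweep_energy)
    fix i assume i: "i < length (path_coefs l)"
    have l': "l \<in> set (leaf_list T)" using l by (simp add: leaf_list_set)
    have "(\<Sum>k<d. path_coefs l ! i $ k * x $ k) = (mat_of_rows d (path_coefs l) *\<^sub>v x) $ i"
      using i x by (auto simp: mat_of_rows_index scalar_prod_def lessThan_atLeast0)
    also have "\<dots> = (\<Sum>j<length (path_coefs l). DL_leaf \<omega> l $$ (i, j) * z l $ j)"
      using i zc[OF l] DL_leaf_carrier[of \<omega> l] unfolding Mz[OF l, symmetric]
      by (auto simp: scalar_prod_def lessThan_atLeast0)
    \<comment> \<open>Separating the diagonal entry of row \<open>i\<close> from the strictly lower
      ones brings the leaf system into the form required by the energy identity.\<close>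
    also have "\<dots> = (\<Sum>j<length (path_coefs l). (if j = i then complex_of_real (s l i) * z l $ i else 0) +
        (if j < i then \<omega> * (\<Sum>k<d. path_coefs l ! i $ k * cnj (path_coefs l ! j $ k)) * z l $ j else 0))"
      unfolding s_def by (rule sum.cong) (auto simp only: index_DL_leaf[OF l' i] lessThan_iff, auto)
    also have "\<dots> = complex_of_real (s l i) * z l $ i +
        (\<Sum>j | j < length (path_coefs l) \<and> j < i.
          \<omega> * (\<Sum>k<d. path_coefs l ! i $ k * cnj (path_coefs l ! j $ k)) * z l $ j)"
      using i by (simp add: sum.distrib sum.inter_filter[symmetric])
    also have "{j. j < length (path_coefs l) \<and> j < i} = {..<i}" using i by auto
    finally show "(\<Sum>k<d. path_coefs l ! i $ k * x $ k) =
        complex_of_real (\<Sum>k<d. (cmod (path_coefs l ! i $ k))\<^sup>2) * z l $ i +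
        \<omega> * (\<Sum>j<i. (\<Sum>k<d. path_coefs l ! i $ k * cnj (path_coefs l ! j $ k)) * z l $ j)"
      by (simp only: s_def sum_distrib_left[symmetric] mult.assoc)
  qed
  have E0: "E l \<ge> 0" for l unfolding E_def s_def by (intro sum_nonneg mult_nonneg_nonneg zero_le_power2)
  have "(\<Sum>k<d. (cmod ((B_mat T \<omega> *\<^sub>v x) $ k))\<^sup>2) \<le>
      (\<Sum>k<d. \<Sum>l\<in>leaves T. path_weight T l * (cmod (y l k))\<^sup>2)"
  proof (rule sum_mono)
    fix k assume "k \<in> {..<d}"
    hence "(B_mat T \<omega> *\<^sub>v x) $ k = (\<Sum>l\<in>leaves T. path_weight T l * y l k)"
      by (simp only: Bx y_def lessThan_iff)
    thus "(cmod ((B_mat T \<omega> *\<^sub>v x) $ k))\<^sup>2 \<le> (\<Sum>l\<in>leaves T. path_weight T l * (cmod (y l k))\<^sup>2)"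
      using cmod_convex_sum_power2_le[OF fin less_imp_le[OF pw] sum_path_weight_leaves]
      by (simp only:)
  qed
  also have "\<dots> = (\<Sum>l\<in>leaves T. path_weight T l * (\<Sum>k<d. (cmod (y l k))\<^sup>2))"
    by (subst sum.swap) (simp add: sum_distrib_left)
  also have "\<dots> = (\<Sum>l\<in>leaves T. path_weight T l * (\<Sum>k<d. (cmod (x $ k))\<^sup>2) -
      \<omega> * (2 - \<omega>) * (path_weight T l * E l))"
    by (rule sum.cong) (simp_all only: energy right_diff_distrib mult_ac)
  also have "\<dots> = (\<Sum>l\<in>leaves T. path_weight T l) * (\<Sum>k<d. (cmod (x $ k))\<^sup>2) -
      \<omega> * (2 - \<omega>) * (\<Sum>l\<in>leaves T. path_weight T l * E l)"
    by (simp only: sum_subtractf sum_distrib_left[where A = "leaves T"] sum_distrib_right[where A = "leaves T"])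
  also have "(\<Sum>l\<in>leaves T. path_weight T l) * (\<Sum>k<d. (cmod (x $ k))\<^sup>2) = (\<Sum>k<d. (cmod (x $ k))\<^sup>2)"
    by (simp only: sum_path_weight_leaves mult_1)
  finally have "\<omega> * (2 - \<omega>) * (\<Sum>l\<in>leaves T. path_weight T l * E l) \<le> 0"
    using ge by linarith
  \<comment> \<open>Both bounds on \<open>\<omega>\<close> enter here, through
    \<open>\<omega> * (2 - \<omega>) > 0\<close>.\<close>
  hence "(\<Sum>l\<in>leaves T. path_weight T l * E l) \<le> 0"
    using \<omega> by (simp add: mult_le_0_iff)
  moreover have nn: "path_weight T l * E l \<ge> 0" if "l \<in> leaves T" for l
    using pw[OF that] E0[of l] by simp
  ultimately have "(\<Sum>l\<in>leaves T. path_weight T l * E l) = 0"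
    by (intro order_antisym sum_nonneg)
  hence wE: "\<forall>l\<in>leaves T. path_weight T l * E l = 0"
    using sum_nonneg_eq_0_iff[OF fin, of "\<lambda>l. path_weight T l * E l"] nn by simp
  have El: "E l = 0" if "l \<in> leaves T" for l
    using bspec[OF wE that] pw[OF that] by simp
  have z0: "z l = 0\<^sub>v (length (path_coefs l))" if l: "l \<in> leaves T" for l
  proof (intro eq_vecI)
    fix i assume "i < dim_vec (0\<^sub>v (length (path_coefs l)) :: complex vec)"
    hence i: "i < length (path_coefs l)" by simp
    have "s l i * (cmod (z l $ i))\<^sup>2 = 0"
    proof -
      have "\<forall>i\<in>{..<length (path_coefs l)}. s l i * (cmod (z l $ i))\<^sup>2 = 0"
        using El[OF l] unfolding E_def s_def
        by (subst (asm) sum_nonneg_eq_0_iff) (intro mult_nonneg_nonneg sum_nonneg zero_le_power2 finite_lessThan)+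
      with i show ?thesis by blast
    qed
    moreover have "s l i > 0" using sq_norm_coef_pos[of l i] l i by (simp add: leaf_list_set s_def)
    ultimately show "z l $ i = 0\<^sub>v (length (path_coefs l)) $ i" using i by simp
  qed (use zc[OF l] in auto)
  have row0: "v \<bullet> x = 0" if v: "v \<in> set all_coefs" for v
  proof -
    obtain l where l: "l \<in> set (leaf_list T)" and v: "v \<in> set (path_coefs l)" using v by auto
    obtain i where i: "i < length (path_coefs l)" "v = path_coefs l ! i"
      using v unfolding in_set_conv_nth by blast
    have "l \<in> leaves T" using l by (simp only: leaf_list_set)
    hence "mat_of_rows d (path_coefs l) *\<^sub>v x =
        DL_leaf \<omega> l *\<^sub>v 0\<^sub>v (length (path_coefs l))"
      using Mz z0 by metis
    also have "\<dots> = 0\<^sub>v (length (path_coefs l))"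
      using DL_leaf_carrier[of \<omega> l] by auto
    finally have "mat_of_rows d (path_coefs l) *\<^sub>v x = 0\<^sub>v (length (path_coefs l))" .
    hence "(mat_of_rows d (path_coefs l) *\<^sub>v x) $ i = 0" using i by simp
    moreover have "path_coefs l ! i \<in> carrier_vec d" using path_coefs_carrier[OF l] v i by blast
    ultimately show ?thesis using i by simp
  qed
  have carr: "set all_coefs \<subseteq> carrier_vec d" using path_coefs_carrier by auto
  show ?thesis unfolding S_mat_eq
  proof (intro eq_vecI)
    fix i assume "i < dim_vec (0\<^sub>v (length all_coefs) :: complex vec)"
    hence i: "i < length all_coefs" by simp
    thus "(mat_of_rows d all_coefs *\<^sub>v x) $ i = 0\<^sub>v (length all_coefs) $ i"
      using row0[OF nth_mem[OF i]] carr nth_mem[OF i] by (simp del: length_concat nth_mem add: subset_iff)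
  qed simp
qed

section \<open>The range of the adjoint as an invariant subspace\<close>

lemma range_S_adj_eq:
  "range_S_adj T = (\<lambda>u. mat_adjoint (S_mat T) *\<^sub>v u) ` carrier_vec (length all_coefs)"
  using S_adj_carrier by (simp add: range_S_adj_def mat_range_def)

lemma range_S_adjI:
  "u \<in> carrier_vec (length all_coefs) \<Longrightarrow> mat_adjoint (S_mat T) *\<^sub>v u \<in> range_S_adj T"
  by (auto simp: range_S_adj_eq)

lemma range_S_adj_carrier: "x \<in> range_S_adj T \<Longrightarrow> x \<in> carrier_vec d"
  unfolding range_S_adj_eq using mult_mat_vec_carrier[OF S_adj_carrier] by blast

lemma range_S_adj_smult:
  assumes "x \<in> range_S_adj T"
  shows "c \<cdot>\<^sub>v x \<in> range_S_adj T"
proof -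
  obtain u where u: "u \<in> carrier_vec (length all_coefs)" "x = mat_adjoint (S_mat T) *\<^sub>v u"
    using assms by (auto simp: range_S_adj_eq)
  hence "c \<cdot>\<^sub>v x = mat_adjoint (S_mat T) *\<^sub>v (c \<cdot>\<^sub>v u)"
    using S_adj_carrier by (simp add: mult_mat_vec)
  with u show ?thesis by (auto intro!: range_S_adjI)
qed

lemma range_S_adj_add:
  assumes "x \<in> range_S_adj T" "y \<in> range_S_adj T"
  shows "x + y \<in> range_S_adj T"
proof -
  obtain u v where uv: "u \<in> carrier_vec (length all_coefs)" "x = mat_adjoint (S_mat T) *\<^sub>v u"
    "v \<in> carrier_vec (length all_coefs)" "y = mat_adjoint (S_mat T) *\<^sub>v v"
    using assms by (auto simp: range_S_adj_eq)
  hence "x + y = mat_adjoint (S_mat T) *\<^sub>v (u + v)"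
    using mult_add_distrib_mat_vec[OF S_adj_carrier uv(1,3)] by simp
  with uv show ?thesis by (auto intro!: range_S_adjI)
qed

lemma range_S_adj_diff:
  assumes "x \<in> range_S_adj T" "y \<in> range_S_adj T"
  shows "x - y \<in> range_S_adj T"
proof -
  have "x - y = x + (-1) \<cdot>\<^sub>v y"
    using range_S_adj_carrier assms by (intro eq_vecI) auto
  with assms show ?thesis by (simp add: range_S_adj_add range_S_adj_smult)
qed

text \<open>\<open>B_mat\<close> changes a point only by a multiple of a vector in the range of the
  adjoint.\<close>

lemma B_mat_range_S_adj:
  assumes "x \<in> range_S_adj T"
  shows "B_mat T \<omega> *\<^sub>v x \<in> range_S_adj T"
  unfolding B_mat_mult_vec[OF range_S_adj_carrier[OF assms]]
  using range_S_adj_carrier[OF assms] S_mat_carrier W_mat_carrier DL_inv_carrier[of \<omega>]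
  by (intro range_S_adj_diff assms range_S_adj_smult range_S_adjI mult_mat_vec_carrier)

lemma b_vec_range_S_adj: "b_vec T \<omega> \<in> range_S_adj T"
proof -
  let ?n = "length all_coefs"
  note c = S_mat_carrier S_adj_carrier W_mat_carrier DL_inv_carrier[of \<omega>]
  have "length (concat (map (\<lambda>l. list_of_vec (b_leaf T l)) (leaf_list T))) = ?n"
    by (simp add: length_concat comp_def b_leaf_def)
  hence b: "b_stack T \<in> carrier_vec ?n"
    unfolding b_stack_def carrier_vec_def by simp
  have "(mat_adjoint (S_mat T) * DL_inv T \<omega> * W_mat T) *\<^sub>v b_stack T =
      mat_adjoint (S_mat T) *\<^sub>v (DL_inv T \<omega> *\<^sub>v (W_mat T *\<^sub>v b_stack T))"
    by (simp only: assoc_mult_mat_vec[OF mult_carrier_mat[OF c(2,4)] c(3) b]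
        assoc_mult_mat_vec[OF c(2,4) mult_mat_vec_carrier[OF c(3) b]])
  thus ?thesis
    unfolding b_vec_def using c b
    by (simp only:) (intro range_S_adj_smult range_S_adjI mult_mat_vec_carrier)
qed

text \<open>Writing \<open>x\<close> as the adjoint applied to \<open>u\<close>, the squared norm of
  \<open>x\<close> equals the inner product of \<open>S_mat T *\<^sub>v x\<close> with
  \<open>u\<close>, which is 0.\<close>

lemma S_mat_kernel_range_S_adj:
  assumes x: "x \<in> range_S_adj T" and Sx: "S_mat T *\<^sub>v x = 0\<^sub>v (length all_coefs)"
  shows "x = 0\<^sub>v d"
proof -
  let ?n = "length all_coefs"
  obtain u where u: "u \<in> carrier_vec ?n" and xu: "x = mat_adjoint (S_mat T) *\<^sub>v u"
    using x by (auto simp: range_S_adj_eq)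
  have xc: "x \<in> carrier_vec d" by (rule range_S_adj_carrier[OF x])
  have Sx0: "(\<Sum>k<d. all_coefs ! i $ k * x $ k) = 0" if i: "i < ?n" for i
  proof -
    have "(\<Sum>k<d. all_coefs ! i $ k * x $ k) = (mat_of_rows d all_coefs *\<^sub>v x) $ i"
      using i xc by (auto simp: mat_of_rows_index scalar_prod_def lessThan_atLeast0)
    also have "\<dots> = 0" using Sx i by (simp add: S_mat_eq)
    finally show ?thesis .
  qed
  have "complex_of_real (\<Sum>k<d. (cmod (x $ k))\<^sup>2) = (\<Sum>k<d. x $ k * cnj (x $ k))"
    by (simp only: of_real_sum complex_norm_square)
  also have "\<dots> = (\<Sum>k<d. \<Sum>i<?n. cnj (u $ i) * (all_coefs ! i $ k * x $ k))"
  proof (rule sum.cong)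
    fix k assume "k \<in> {..<d}"
    hence "cnj (x $ k) = (\<Sum>i<?n. all_coefs ! i $ k * cnj (u $ i))"
      using S_adj_mult_vec_index[of k u] u unfolding xu by (simp del: length_concat)
    thus "x $ k * cnj (x $ k) = (\<Sum>i<?n. cnj (u $ i) * (all_coefs ! i $ k * x $ k))"
      by (simp only: sum_distrib_left mult_ac)
  qed simp
  also have "\<dots> = (\<Sum>i<?n. cnj (u $ i) * (\<Sum>k<d. all_coefs ! i $ k * x $ k))"
    by (subst sum.swap) (simp only: sum_distrib_left)
  also have "\<dots> = 0" using Sx0 by (intro sum.neutral) (simp del: length_concat)
  finally have "(\<Sum>k<d. (cmod (x $ k))\<^sup>2) = 0" by (simp only: of_real_eq_0_iff)
  hence "\<forall>k<d. x $ k = 0" by (simp add: sum_nonneg_eq_0_iff)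
  thus ?thesis using xc by (intro eq_vecI) auto
qed

section \<open>The spectrum of the iteration matrix on the range of the adjoint\<close>

text \<open>Multiplication by a scalar of modulus at least 1 does not decrease the norm, so
  \<open>x\<close> lies in the kernel of \<open>S_mat\<close>, which meets the range of the adjoint
  only in 0.\<close>

lemma B_mat_eigenvector_range_S_adj:
  assumes x: "x \<in> range_S_adj T" and \<omega>: "0 < \<omega>" "\<omega> < 2"
    and eig: "B_mat T \<omega> *\<^sub>v x = c \<cdot>\<^sub>v x" and c: "cmod c \<ge> 1"
  shows "x = 0\<^sub>v d"
proof (rule S_mat_kernel_range_S_adj[OF x], rule norm_B_mat_ge_imp_kernel_S_mat[OF _ \<omega>])
  show xc: "x \<in> carrier_vec d" by (rule range_S_adj_carrier[OF x])
  have "(cmod (x $ k))\<^sup>2 \<le> (cmod ((B_mat T \<omega> *\<^sub>v x) $ k))\<^sup>2" if "k < d" for k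
    using that xc mult_right_mono[OF c, of "cmod (x $ k)"] unfolding eig
    by (auto simp: norm_mult intro!: power_mono)
  thus "(\<Sum>k<d. (cmod (x $ k))\<^sup>2) \<le> (\<Sum>k<d. (cmod ((B_mat T \<omega> *\<^sub>v x) $ k))\<^sup>2)"
    by (intro sum_mono) auto
qed

text \<open>In dimension 0 the coefficient vector of the root would be zero. Positive dimension
  guarantees that eigenvalues exist, so that the spectral radius is attained.\<close>

lemma space_dim_pos: "d > 0"
proof (rule ccontr)
  assume "\<not> d > 0"
  hence "coef T (tree_root T) = 0\<^sub>v d"
    using coef_carrier[OF root_in_nodes] by (intro eq_vecI) auto
  thus False using coef_nonzero[OF root_in_nodes] by simp
qed

text \<open>On the whole space \<open>B_mat\<close> is the identity on the kernel of \<open>S_mat\<close>, so its spectral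
  radius can be 1.  Composing it with any linear map that fixes the range of the adjoint pointwise
  and maps into it removes these eigenvectors.\<close>

lemma B_mat_restriction:
  assumes \<omega>: "0 < \<omega>" "\<omega> < 2"
  obtains A where "A \<in> carrier_mat d d" "spectral_radius A < 1"
    "\<And>x. x \<in> range_S_adj T \<Longrightarrow> A *\<^sub>v x = B_mat T \<omega> *\<^sub>v x"
    "\<And>x. x \<in> carrier_vec d \<Longrightarrow> A *\<^sub>v x \<in> range_S_adj T"
proof -
  obtain G where G: "G \<in> carrier_mat (length all_coefs) d"
    and AGA: "mat_adjoint (S_mat T) * G * mat_adjoint (S_mat T) = mat_adjoint (S_mat T)"
    using ex_generalized_inverse[OF S_adj_carrier] by blast
  \<comment> \<open>The generalized inverse makes \<open>P\<close> a projection onto the range of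
    the adjoint, possibly an oblique one.\<close>
  define P where "P = mat_adjoint (S_mat T) * G"
  have P: "P \<in> carrier_mat d d" using G S_adj_carrier by (auto simp: P_def)
  define A where "A = B_mat T \<omega> * P"
  have A: "A \<in> carrier_mat d d" unfolding A_def by (rule mult_carrier_mat[OF B_mat_carrier P])
  have Ax: "A *\<^sub>v x = B_mat T \<omega> *\<^sub>v (P *\<^sub>v x)" if "x \<in> carrier_vec d" for x
    unfolding A_def by (rule assoc_mult_mat_vec[OF B_mat_carrier P that])
  have P_range: "P *\<^sub>v x \<in> range_S_adj T" if "x \<in> carrier_vec d" for x
    unfolding P_def using that G
    by (simp only: assoc_mult_mat_vec[OF S_adj_carrier G that]) (intro range_S_adjI mult_mat_vec_carrier)
  have P_id: "P *\<^sub>v x = x" if x: "x \<in> range_S_adj T" for x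
  proof -
    obtain u where u: "u \<in> carrier_vec (length all_coefs)" "x = mat_adjoint (S_mat T) *\<^sub>v u"
      using x by (auto simp: range_S_adj_eq)
    thus ?thesis using assoc_mult_mat_vec[OF P S_adj_carrier u(1)] AGA by (simp only: P_def)
  qed
  have A_range: "A *\<^sub>v x \<in> range_S_adj T" if "x \<in> carrier_vec d" for x
    unfolding Ax[OF that] using that by (intro B_mat_range_S_adj P_range)
  have "spectral_radius A < 1"
  proof (rule ccontr)
    assume "\<not> spectral_radius A < 1"
    then obtain c where c: "cmod c \<ge> 1" "eigenvalue A c"
      using spectral_radius_mem_max(1)[OF A space_dim_pos] by (force simp: spectrum_def)
    then obtain v where v: "v \<in> carrier_vec d" "v \<noteq> 0\<^sub>v d" "A *\<^sub>v v = c \<cdot>\<^sub>v v"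
      using A by (auto simp: eigenvalue_def eigenvector_def)
    \<comment> \<open>As \<open>c\<close> is nonzero, the eigenvector lies in the range of
      \<open>A\<close>, hence in the range of the adjoint, where \<open>A\<close> acts as
      \<open>B_mat\<close>.\<close>
    have "v = (1 / c) \<cdot>\<^sub>v (A *\<^sub>v v)"
      using c v by (auto simp: smult_smult_assoc)
    hence vR: "v \<in> range_S_adj T"
      using range_S_adj_smult[OF A_range[OF v(1)]] by metis
    have "B_mat T \<omega> *\<^sub>v v = c \<cdot>\<^sub>v v"
      using v Ax[OF v(1)] P_id[OF vR] by simp
    with B_mat_eigenvector_range_S_adj[OF vR \<omega> _ c(1)] v(2) show False by blast
  qed
  with A A_range show thesis
    using Ax P_id range_S_adj_carrier by (intro that[of A]) auto
qed

end

section \<open>Convergence of the affine iteration to its fixed point\<close>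

theorem corollary12:
  fixes T :: "'v tree_system" and \<omega> :: real
  assumes "kaczmarz_tree T"
    and "\<omega> \<in> {0<..<2}"
  shows "\<exists>x_lim \<in> range_S_adj T.
           (\<forall>x. kaczmarz_seq T \<omega> x \<longrightarrow> cvec_tendsto x x_lim) \<and>
           (\<forall>y \<in> range_S_adj T.
              (\<exists>x. kaczmarz_seq T \<omega> x \<and> cvec_tendsto x y) \<longrightarrow> y = x_lim) \<and>
           (\<exists>q \<in> {0<..<1}. \<forall>x. kaczmarz_seq T \<omega> x \<longrightarrow>
              (\<exists>C \<ge> 0. \<forall>n. cvec_norm (x n - x_lim) \<le> C * q ^ n))"
proof -
  interpret kaczmarz_tree T by (rule assms(1))
  let ?R = "range_S_adj T"
  obtain A where A: "A \<in> carrier_mat d d" and sr: "spectral_radius A < 1"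
    and AB: "\<And>x. x \<in> ?R \<Longrightarrow> A *\<^sub>v x = B_mat T \<omega> *\<^sub>v x"
    and AR: "\<And>x. x \<in> carrier_vec d \<Longrightarrow> A *\<^sub>v x \<in> ?R"
    using B_mat_restriction[of \<omega>] assms(2) by auto
  obtain q c where q: "q \<in> {0<..<1}" and c: "c \<ge> 0" and bound: "\<And>k. norm_bound (A ^\<^sub>m k) (c * q ^ k)"
    using spectral_radius_less_1_geometric_bound[OF A space_dim_pos sr] by blast
  have b: "b_vec T \<omega> \<in> carrier_vec d" by (rule range_S_adj_carrier[OF b_vec_range_S_adj])
  obtain x_lim where xl: "x_lim \<in> carrier_vec d" and fp: "x_lim = A *\<^sub>v x_lim + b_vec T \<omega>"
    using affine_fixed_point[OF A space_dim_pos sr b] by blast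
  \<comment> \<open>Both terms of the fixed point equation lie in the range, although the fixed
    point was found in the whole space.\<close>
  have xlR: "x_lim \<in> ?R"
    by (subst fp) (intro range_S_adj_add AR xl b_vec_range_S_adj)
  \<comment> \<open>Membership in the range is proved together with the error formula, because
    \<open>B_hat\<close> agrees with \<open>B_mat\<close>, and \<open>B_mat\<close> with
    \<open>A\<close>, only on points of the range.\<close>
  have seqR: "x n \<in> ?R" and err: "x n - x_lim = A ^\<^sub>m n *\<^sub>v (x 0 - x_lim)"
    if x: "kaczmarz_seq T \<omega> x" for x n
  proof -
    have "x n \<in> ?R \<and> x n - x_lim = A ^\<^sub>m n *\<^sub>v (x 0 - x_lim)"
    proof (induction n)
      case 0
      have "x 0 \<in> ?R" using x by (simp add: kaczmarz_seq_def)
      thus ?case using A range_S_adj_carrier[of "x 0"] xl by simp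
    next
      case (Suc n)
      hence xn: "x n \<in> carrier_vec d" by (simp add: range_S_adj_carrier)
      have x0: "x 0 \<in> carrier_vec d"
        using x by (intro range_S_adj_carrier) (simp add: kaczmarz_seq_def)
      have step: "x (Suc n) = A *\<^sub>v x n + b_vec T \<omega>"
        using x Suc by (simp add: kaczmarz_seq_def B_hat_def AB)
      have carr: "A *\<^sub>v x n \<in> carrier_vec d" "A *\<^sub>v x_lim \<in> carrier_vec d"
        using mult_mat_vec_carrier[OF A] xn xl by auto
      have "x (Suc n) - x_lim = (A *\<^sub>v x n + b_vec T \<omega>) - (A *\<^sub>v x_lim + b_vec T \<omega>)"
        by (simp only: step fp[symmetric])
      also have "\<dots> = A *\<^sub>v x n - A *\<^sub>v x_lim"
        by (rule add_diff_cancel_right_vec[OF carr b])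
      also have "\<dots> = A *\<^sub>v (x n - x_lim)"
        by (rule mult_minus_distrib_mat_vec[OF A xn xl, symmetric])
      also have "\<dots> = A *\<^sub>v (A ^\<^sub>m n *\<^sub>v (x 0 - x_lim))" using Suc by simp
      also have "\<dots> = (A * A ^\<^sub>m n) *\<^sub>v (x 0 - x_lim)"
        using assoc_mult_mat_vec[OF A pow_carrier_mat[OF A], of "x 0 - x_lim" n] x0 xl by simp
      also have "A * A ^\<^sub>m n = A ^\<^sub>m Suc n"
        by (rule pow_mat_Suc_left[OF A, symmetric])
      finally show ?case
        using step AR[OF xn] b_vec_range_S_adj by (simp add: range_S_adj_add)
    qed
    thus "x n \<in> ?R" "x n - x_lim = A ^\<^sub>m n *\<^sub>v (x 0 - x_lim)" by auto
  qed
  \<comment> \<open>The rate \<open>q\<close> comes from \<open>A\<close> and is shared by all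
    sequences. Only \<open>C\<close> depends on the sequence, through the initial error.\<close>
  have lin: "\<exists>C \<ge> 0. \<forall>n. cvec_norm (x n - x_lim) \<le> C * q ^ n" if x: "kaczmarz_seq T \<omega> x" for x
  proof (intro exI conjI allI)
    let ?C = "d * (\<Sum>j<d. cmod ((x 0 - x_lim) $ j)) * c"
    show "?C \<ge> 0" using c by (auto intro!: mult_nonneg_nonneg sum_nonneg)
    have e: "x 0 - x_lim \<in> carrier_vec d" using range_S_adj_carrier[OF seqR[OF x]] xl by auto
    show "cvec_norm (x n - x_lim) \<le> ?C * q ^ n" for n
      unfolding err[OF x, of n]
      using cvec_norm_mult_mat_vec_le[OF pow_carrier_mat[OF A] e bound] by (simp add: mult.assoc)
  qed
  have lim: "cvec_tendsto x x_lim" if x: "kaczmarz_seq T \<omega> x" for x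
  proof -
    obtain C where C: "\<And>n. cvec_norm (x n - x_lim) \<le> C * q ^ n" using lin[OF x] by blast
    have "(\<lambda>n. C * q ^ n) \<longlonglongrightarrow> C * 0"
      using q by (intro tendsto_mult tendsto_const LIMSEQ_power_zero) auto
    hence Cq: "(\<lambda>n. C * q ^ n) \<longlonglongrightarrow> 0" by simp
    have "0 \<le> cvec_norm v" for v by (simp add: cvec_norm_def)
    thus ?thesis
      unfolding cvec_tendsto_def
      by (intro tendsto_sandwich[OF always_eventually always_eventually tendsto_const Cq] allI C)
  qed
  show ?thesis
  proof (intro bexI[OF _ xlR] conjI allI ballI impI)
    fix y assume y: "y \<in> ?R" and "\<exists>x. kaczmarz_seq T \<omega> x \<and> cvec_tendsto x y"
    then obtain x where x: "kaczmarz_seq T \<omega> x" "cvec_tendsto x y" by blast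
    show "y = x_lim"
      using cvec_tendsto_unique[OF x(2) lim[OF x(1)]] range_S_adj_carrier seqR[OF x(1)] y xl by blast
  next
    show "\<exists>q \<in> {0<..<1}. \<forall>x. kaczmarz_seq T \<omega> x \<longrightarrow>
        (\<exists>C \<ge> 0. \<forall>n. cvec_norm (x n - x_lim) \<le> C * q ^ n)"
      using q lin by blast
  qed (rule lim)
qed

end
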